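(* Let $d,k$ be positive integers. There exists $N=N(d,k)$ such that for every integer $n\ge N$, the value of the multiple-treasures-per-door search game with parameters $(n,d,k)$ is $$v_M(n,d,k)=\frac{k^d}{\binom{n+d-1}d}.$$
   Context: The multiple-treasures-per-door search game with parameters $(n,d,k)$ is the following two-player zero-sum game. First the hider places $d$ treasures behind $n$ doors; several treasures may be placed behind the same door. Then the searcher plays rounds: in each round she selects (guesses) a set of at most $k$ doors. If none of the selected doors hides a treasure not yet found, she loses immediately. Otherwise the hider reveals one not-yet-found treasure behind one of the selected doors (the hider chooses which one if there are several). The searcher wins if she finds all $d$ treasures with a total of $d$ guesses (rounds). The searcher's choices may be randomized and may depend on all previous answers; the hider may randomize. The value $v_M(n,d,k)$ is the probability that the searcher wins when both players play optimally. *)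

theory Defs
  imports "HOL-Probability.Probability_Mass_Function" "HOL-Library.Multiset"
begin

text \<open>Doors are the natural numbers 0..n-1.  A pure searcher strategy maps the list of
doors revealed so far (the answers) to the next guessed set of doors.  A pure hider
strategy consists of a placement (a multiset of d doors) and a reveal rule mapping
the full history (guessed sets and answers) and the current guess to a door.
If the rule names an illegal door, the least legal door is revealed instead,
so every legal hider behaviour is represented and only legal ones occur.\<close>

type_synonym searcher = "nat list \<Rightarrow> nat set"
type_synonym hrule = "(nat set \<times> nat) list \<Rightarrow> nat set \<Rightarrow> nat"

fun wins :: "nat \<Rightarrow> searcher \<Rightarrow> hrule \<Rightarrow> nat multiset \<Rightarrow> (nat set \<times> nat) list \<Rightarrow> bool" where
  "wins 0 \<sigma> \<rho> M h = True"
| "wins (Suc m) \<sigma> \<rho> M h =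
    (let S = \<sigma> (map snd h); A = S \<inter> set_mset M in
     if A = {} then False
     else (let x = (if \<rho> h S \<in> A then \<rho> h S else Min A)
           in wins m \<sigma> \<rho> (M - {#x#}) (h @ [(S, x)])))"

definition valid_searcher :: "nat \<Rightarrow> nat \<Rightarrow> searcher \<Rightarrow> bool" where
  "valid_searcher n k \<sigma> \<longleftrightarrow>
     (\<forall>hs. finite (\<sigma> hs) \<and> \<sigma> hs \<subseteq> {..<n} \<and> card (\<sigma> hs) \<le> k)"

definition placements :: "nat \<Rightarrow> nat \<Rightarrow> nat multiset set" where
  "placements n d = {c. set_mset c \<subseteq> {..<n} \<and> size c = d}"

definition win_prob :: "nat \<Rightarrow> searcher pmf \<Rightarrow> nat multiset \<Rightarrow> hrule \<Rightarrow> real" where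
  "win_prob d p c \<rho> = measure_pmf.prob p {\<sigma>. wins d \<sigma> \<rho> c []}"

text \<open>Value of the game: best guaranteed winning probability of a mixed searcher strategy
against every pure hider strategy (equals the game value by the minimax theorem).\<close>
definition vM :: "nat \<Rightarrow> nat \<Rightarrow> nat \<Rightarrow> real" where
  "vM n d k =
     (SUP p \<in> {p. set_pmf p \<subseteq> {\<sigma>. valid_searcher n k \<sigma>}}.
        INF hc \<in> placements n d \<times> (UNIV :: hrule set). win_prob d p (fst hc) (snd hc))"

end

theory Submission
  imports Defs "HOL-Probability.Product_PMF"
begin

text \<open>Upper bound: against a fixed reveal rule, a pure searcher strategy has at most \<open>k ^ d\<close> winning
  answer sequences, and such a sequence determines the placement; averaging over all placements
  gives the bound.

  Lower bound: the searcher only guesses doors never guessed before and possibly the door \<open>x\<close>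
  revealed last. When \<open>r\<close> distinct doors have been revealed and \<open>m\<close> treasures are still hidden, she
  guesses \<open>x\<close> together with \<open>k - 1\<close> random new doors with probability
  \<open>q = k * (r + m) / (n + m)\<close>, and \<open>k\<close> random new doors otherwise; \<open>q \<le> 1\<close> once \<open>n \<ge> k * d\<close>.
  She can only win while each guess contains exactly one door with a hidden treasure, so
  the reveal rule does not matter. By Vandermonde's identity this choice of \<open>q\<close> makes each
  set of \<open>r - 1\<close> positions at which the revealed door changes appear with probability
  \<open>(n choose r) / ((n + d - 1) choose d)\<close> along a uniformly random answer sequence, so that
  every multiset of doors is equally likely.\<close>

section \<open>The upper bound\<close>

text \<open>Induction on the rounds left: the guess admits at most \<open>k\<close> answers
  \<open>x\<close>, and putting \<open>x\<close> back into a multiset won afterwards recovers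
  \<open>M\<close>.\<close>

lemma finite_card_won_multisets:
  assumes "valid_searcher n k \<sigma>"
  shows "finite {M. size M = m \<and> wins m \<sigma> \<rho> M h} \<and> card {M. size M = m \<and> wins m \<sigma> \<rho> M h} \<le> k ^ m"
proof (induction m arbitrary: h)
  case 0
  have "{M :: nat multiset. size M = 0 \<and> wins 0 \<sigma> \<rho> M h} = {{#}}" by auto
  then show ?case by simp
next
  case (Suc m)
  define S where "S = \<sigma> (map snd h)"
  have S: "finite S" "card S \<le> k"
    using assms by (auto simp: valid_searcher_def S_def)
  define W where "W x = {M. size M = m \<and> wins m \<sigma> \<rho> M (h @ [(S, x)])}" for x
  have W: "finite (W x)" "card (W x) \<le> k ^ m" for x
    using Suc.IH[of "h @ [(S, x)]"] by (auto simp: W_def)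
  have sub: "{M. size M = Suc m \<and> wins (Suc m) \<sigma> \<rho> M h} \<subseteq> (\<Union>x\<in>S. add_mset x ` W x)"
  proof
    fix M assume "M \<in> {M. size M = Suc m \<and> wins (Suc m) \<sigma> \<rho> M h}"
    then have sz: "size M = Suc m" and w: "wins (Suc m) \<sigma> \<rho> M h" by auto
    define A where "A = S \<inter> set_mset M"
    define x where "x = (if \<rho> h S \<in> A then \<rho> h S else Min A)"
    have A: "A \<noteq> {}" "finite A" and w': "wins m \<sigma> \<rho> (M - {#x#}) (h @ [(S, x)])"
      using w by (auto simp: A_def x_def S_def Let_def split: if_splits)
    then have "x \<in> A" by (auto simp: x_def)
    then have "x \<in> S" "x \<in># M" by (auto simp: A_def)
    moreover have "M - {#x#} \<in> W x" "M = add_mset x (M - {#x#})"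
      using w' sz \<open>x \<in># M\<close> by (auto simp: W_def size_Diff_singleton)
    ultimately show "M \<in> (\<Union>x\<in>S. add_mset x ` W x)" by blast
  qed
  have fin: "finite (\<Union>x\<in>S. add_mset x ` W x)" using S W by auto
  have "card (\<Union>x\<in>S. add_mset x ` W x) \<le> (\<Sum>x\<in>S. card (add_mset x ` W x))"
    by (rule card_UN_le) (rule S)
  also have "\<dots> \<le> (\<Sum>x\<in>S. k ^ m)"
    by (intro sum_mono order_trans[OF card_image_le] W)
  also have "\<dots> \<le> k ^ Suc m" using S by simp
  finally show ?case
    using finite_subset[OF sub fin] card_mono[OF fin sub] by linarith
qed

lemma placements_eq: "placements n d = multisets_of_size {..<n} d"
  by (simp add: placements_def multisets_of_size_def)

text \<open>The sum is the expected number of placements won, and each pure strategy in the support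
  wins at most \<open>k ^ d\<close> of them against \<open>\<rho>\<close>.\<close>

lemma sum_win_prob_le:
  assumes "set_pmf p \<subseteq> {\<sigma>. valid_searcher n k \<sigma>}"
  shows "(\<Sum>c\<in>placements n d. win_prob d p c \<rho>) \<le> real k ^ d"
proof -
  have fin: "finite (placements n d)" by (auto simp: placements_eq)
  have "(\<Sum>c\<in>placements n d. win_prob d p c \<rho>) =
      (\<Sum>c\<in>placements n d. measure_pmf.expectation p (indicator {\<sigma>. wins d \<sigma> \<rho> c []}))"
    by (simp add: win_prob_def)
  also have "\<dots> = measure_pmf.expectation p
      (\<lambda>\<sigma>. \<Sum>c\<in>placements n d. indicator {\<sigma>. wins d \<sigma> \<rho> c []} \<sigma>)"
    by (subst Bochner_Integration.integral_sum)
       (auto intro!: measure_pmf.integrable_const_bound[where B = 1])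
  also have "\<dots> \<le> measure_pmf.expectation p (\<lambda>_. real k ^ d)"
  proof (rule integral_mono_AE)
    show "integrable (measure_pmf p)
        (\<lambda>\<sigma>. \<Sum>c\<in>placements n d. indicator {\<sigma>. wins d \<sigma> \<rho> c []} \<sigma> :: real)"
      by (intro Bochner_Integration.integrable_sum measure_pmf.integrable_const_bound[where B = 1]) auto
    show "AE \<sigma> in measure_pmf p.
        (\<Sum>c\<in>placements n d. indicator {\<sigma>. wins d \<sigma> \<rho> c []} \<sigma>) \<le> real k ^ d"
    proof (rule AE_pmfI)
      fix \<sigma> assume "\<sigma> \<in> set_pmf p"
      then have v: "valid_searcher n k \<sigma>" using assms by auto
      have "(\<Sum>c\<in>placements n d. indicator {\<sigma>. wins d \<sigma> \<rho> c []} \<sigma>) =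
          (\<Sum>c\<in>placements n d. indicator {c. wins d \<sigma> \<rho> c []} c :: real)"
        by (auto simp: indicator_def)
      also have "\<dots> = real (card (placements n d \<inter> {c. wins d \<sigma> \<rho> c []}))"
        using fin by (simp add: indicator_def Int_def)
      also have "\<dots> \<le> real (card {M. size M = d \<and> wins d \<sigma> \<rho> M []})"
        using finite_card_won_multisets[OF v]
        by (intro of_nat_mono card_mono) (auto simp: placements_def)
      also have "\<dots> \<le> real (k ^ d)"
        using finite_card_won_multisets[OF v] by (intro of_nat_mono) auto
      finally show "(\<Sum>c\<in>placements n d. indicator {\<sigma>. wins d \<sigma> \<rho> c []} \<sigma>) \<le> real k ^ d"
        by simp
    qed
  qed simp
  finally show ?thesis by simp
qed

section \<open>Gluing randomized strategies\<close>

text \<open>A played prefix is absorbed into strategy and rule; a prefix of one round gives the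
  recursion on the first round in \<open>wins_Suc_Nil\<close>.\<close>

lemma wins_append_history:
  "wins m \<sigma> \<rho> M (h0 @ h) = wins m (\<lambda>ys. \<sigma> (map snd h0 @ ys)) (\<lambda>h. \<rho> (h0 @ h)) M h"
  by (induction m arbitrary: M h) (simp_all add: Let_def)

lemma wins_Suc_Nil:
  "wins (Suc m) \<sigma> \<rho> M [] =
    (let S = \<sigma> []; A = S \<inter> set_mset M; x = (if \<rho> [] S \<in> A then \<rho> [] S else Min A)
     in A \<noteq> {} \<and> wins m (\<lambda>ys. \<sigma> (x # ys)) (\<lambda>h. \<rho> ((S, x) # h)) (M - {#x#}) [])"
  using wins_append_history[of m \<sigma> \<rho> _ "[_]" "[]"] by (simp add: Let_def)

lemma prob_bind_pmf:
  "measure_pmf.prob (bind_pmf p K) X = measure_pmf.expectation p (\<lambda>x. measure_pmf.prob (K x) X)"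
  unfolding measure_pmf_bind
  by (rule measure_pmf.measure_bind[where N = "count_space UNIV"])
     (auto simp: measure_pmf_in_subprob_algebra)

text \<open>A plan that randomizes anew after each answer becomes a distribution on pure strategies
  by drawing one continuation per door in advance, independently. Answers that are not doors get the
  strategy that guesses nothing, which is valid.\<close>

definition glue :: "nat \<Rightarrow> (nat \<Rightarrow> searcher pmf) \<Rightarrow> nat set \<Rightarrow> searcher pmf" where
  "glue n C S = map_pmf (\<lambda>g ys. case ys of [] \<Rightarrow> S | y # zs \<Rightarrow> g y zs) (Pi_pmf {..<n} (\<lambda>_. {}) C)"

lemma set_pmf_glue:
  assumes "S \<subseteq> {..<n}" "card S \<le> k" "\<And>y. set_pmf (C y) \<subseteq> {\<sigma>. valid_searcher n k \<sigma>}"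
  shows "set_pmf (glue n C S) \<subseteq> {\<sigma>. valid_searcher n k \<sigma>}"
proof
  fix \<sigma> assume "\<sigma> \<in> set_pmf (glue n C S)"
  then obtain g where g: "g \<in> PiE_dflt {..<n} (\<lambda>_. {}) (set_pmf \<circ> C)"
    and \<sigma>: "\<sigma> = (\<lambda>ys. case ys of [] \<Rightarrow> S | y # zs \<Rightarrow> g y zs)"
    by (auto simp: glue_def set_Pi_pmf)
  have "valid_searcher n k (g y)" for y
    using g assms(3)[of y] by (cases "y < n") (auto simp: PiE_dflt_def valid_searcher_def)
  then show "\<sigma> \<in> {\<sigma>. valid_searcher n k \<sigma>}"
    using assms(1,2) finite_subset[OF assms(1)]
    by (auto simp: \<sigma> valid_searcher_def split: list.split)
qed

text \<open>The answer is \<open>y\<close> whatever \<open>\<rho>\<close> says, and the marginal of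
  the product at \<open>y\<close> is \<open>C y\<close>.\<close>

lemma prob_glue:
  assumes "S \<inter> set_mset M = {y}" "y < n"
  shows "measure_pmf.prob (glue n C S) {\<sigma>. wins (Suc m) \<sigma> \<rho> M []} =
    measure_pmf.prob (C y) {\<sigma>. wins m \<sigma> (\<lambda>h. \<rho> ((S, y) # h)) (M - {#y#}) []}"
proof -
  have "measure_pmf.prob (glue n C S) {\<sigma>. wins (Suc m) \<sigma> \<rho> M []} =
    measure_pmf.prob (map_pmf (\<lambda>g. g y) (Pi_pmf {..<n} (\<lambda>_. {}) C))
      {\<sigma>. wins m \<sigma> (\<lambda>h. \<rho> ((S, y) # h)) (M - {#y#}) []}"
    using assms(1) by (auto simp: glue_def wins_Suc_Nil Let_def simp del: wins.simps
        intro!: arg_cong[where f = "measure _"])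
  also have "\<dots> = measure_pmf.prob (C y) {\<sigma>. wins m \<sigma> (\<lambda>h. \<rho> ((S, y) # h)) (M - {#y#}) []}"
    using assms(2) by (subst Pi_pmf_component) auto
  finally show ?thesis .
qed

text \<open>\<open>E\<close> is the prescribed part of the guess. The continuation receives the
  whole guess, since it has to know which doors have been touched.\<close>

definition random_guess ::
    "nat \<Rightarrow> (nat set \<Rightarrow> nat \<Rightarrow> searcher pmf) \<Rightarrow> nat set \<Rightarrow> nat set \<Rightarrow> nat \<Rightarrow> searcher pmf" where
  "random_guess n C E A j =
     bind_pmf (pmf_of_set {U. U \<subseteq> A \<and> card U = j}) (\<lambda>U. glue n (C (E \<union> U)) (E \<union> U))"

lemma subsets_of_card_nonempty: "finite A \<Longrightarrow> j \<le> card A \<Longrightarrow> {U. U \<subseteq> A \<and> card U = j} \<noteq> {}"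
  by (auto dest: obtain_subset_with_card_n)

lemma set_pmf_random_guess:
  assumes "E \<subseteq> {..<n}" "A \<subseteq> {..<n}" "j \<le> card A" "card E + j \<le> k"
    and "\<And>S y. set_pmf (C S y) \<subseteq> {\<sigma>. valid_searcher n k \<sigma>}"
  shows "set_pmf (random_guess n C E A j) \<subseteq> {\<sigma>. valid_searcher n k \<sigma>}"
proof -
  have fin: "finite A" using assms(2) finite_subset by blast
  have "set_pmf (glue n (C (E \<union> U)) (E \<union> U)) \<subseteq> {\<sigma>. valid_searcher n k \<sigma>}"
    if "U \<subseteq> A" "card U = j" for U
    using that assms card_Un_le[of E U] by (intro set_pmf_glue) auto
  then show ?thesis
    using subsets_of_card_nonempty[OF fin assms(3)] fin by (auto simp: random_guess_def)
qed

text \<open>\<open>X\<close> collects draws for which the answer is forced; all other draws are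
  estimated by 0.\<close>

lemma prob_random_guess_ge:
  assumes "finite A" "j \<le> card A"
    and X: "X \<subseteq> {U. U \<subseteq> A \<and> card U = j}"
    and single: "\<And>U. U \<in> X \<Longrightarrow> \<exists>y<n. (E \<union> U) \<inter> set_mset M = {y} \<and>
      c \<le> measure_pmf.prob (C (E \<union> U) y) {\<sigma>. wins m \<sigma> (\<lambda>h. \<rho> ((E \<union> U, y) # h)) (M - {#y#}) []}"
  shows "real (card X) / real (card A choose j) * c \<le>
    measure_pmf.prob (random_guess n C E A j) {\<sigma>. wins (Suc m) \<sigma> \<rho> M []}"
proof -
  let ?Us = "{U. U \<subseteq> A \<and> card U = j}"
  let ?P = "\<lambda>U. measure_pmf.prob (glue n (C (E \<union> U)) (E \<union> U)) {\<sigma>. wins (Suc m) \<sigma> \<rho> M []}"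
  have fin: "finite ?Us" and ne: "?Us \<noteq> {}"
    using assms(1) subsets_of_card_nonempty[OF assms(1,2)] by auto
  have "real (card X) * c = (\<Sum>U\<in>X. c)" by simp
  also have "\<dots> \<le> (\<Sum>U\<in>X. ?P U)"
  proof (rule sum_mono)
    fix U assume "U \<in> X"
    from single[OF this] show "c \<le> ?P U" using prob_glue by force
  qed
  also have "\<dots> \<le> (\<Sum>U\<in>?Us. ?P U)"
    using X fin by (intro sum_mono2) auto
  finally have "real (card X) * c / real (card ?Us) \<le> (\<Sum>U\<in>?Us. ?P U) / real (card ?Us)"
    by (rule divide_right_mono) simp
  then show ?thesis
    using fin ne
    by (simp add: random_guess_def prob_bind_pmf integral_pmf_of_set n_subsets[OF assms(1)] del: wins.simps)
qed

section \<open>Counting subsets\<close>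

lemma card_subsets_disjoint:
  assumes "finite A" "B \<subseteq> A"
  shows "card {U. U \<subseteq> A \<and> card U = j \<and> U \<inter> B = {}} = (card A - card B) choose j"
proof -
  have "{U. U \<subseteq> A \<and> card U = j \<and> U \<inter> B = {}} = {U. U \<subseteq> A - B \<and> card U = j}" by auto
  then show ?thesis
    using assms finite_subset[OF assms(2,1)] by (simp add: n_subsets card_Diff_subset)
qed

lemma card_subsets_meeting_once:
  assumes "finite A" "B \<subseteq> A"
  shows "card {U. U \<subseteq> A \<and> card U = Suc j \<and> (\<exists>y. U \<inter> B = {y})} =
    card B * ((card A - card B) choose j)"
proof -
  let ?V = "{U. U \<subseteq> A - B \<and> card U = j}"
  have finB: "finite B" using assms finite_subset by blast
  have "bij_betw (\<lambda>(y, V). insert y V) (B \<times> ?V) {U. U \<subseteq> A \<and> card U = Suc j \<and> (\<exists>y. U \<inter> B = {y})}"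
  proof (rule bij_betwI')
    fix u v assume "u \<in> B \<times> ?V" "v \<in> B \<times> ?V"
    then obtain y V y' V' where uv: "u = (y, V)" "v = (y', V')" "y \<in> B" "y' \<in> B" "V \<subseteq> A - B" "V' \<subseteq> A - B"
      by auto
    then have inv: "insert y V \<inter> B = {y}" "insert y' V' \<inter> B = {y'}" "insert y V - B = V" "insert y' V' - B = V'"
      by auto
    have "{y} = {y'} \<and> V = V'" if "insert y V = insert y' V'"
      using inv(1,3) unfolding that inv(2,4) by blast
    then show "((\<lambda>(y, V). insert y V) u = (\<lambda>(y, V). insert y V) v) = (u = v)"
      unfolding uv by auto
  next
    fix u assume u: "u \<in> B \<times> ?V"
    then obtain y V where yV: "u = (y, V)" "y \<in> B" "V \<subseteq> A - B" "card V = j" by auto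
    then have "finite V" "y \<notin> V" using assms finite_subset[of V A] by auto
    then have "card (insert y V) = Suc j" using yV by simp
    moreover have "insert y V \<inter> B = {y}" using yV by auto
    ultimately show "(\<lambda>(y, V). insert y V) u \<in> {U. U \<subseteq> A \<and> card U = Suc j \<and> (\<exists>y. U \<inter> B = {y})}"
      using yV assms by auto
  next
    fix U assume "U \<in> {U. U \<subseteq> A \<and> card U = Suc j \<and> (\<exists>y. U \<inter> B = {y})}"
    then obtain y where U: "U \<subseteq> A" "card U = Suc j" "U \<inter> B = {y}" by auto
    then have "finite U" "y \<in> U" "y \<in> B" using assms finite_subset by auto
    then have "U = insert y (U - {y})" "(y, U - {y}) \<in> B \<times> ?V" using U by auto
    then show "\<exists>u\<in>B \<times> ?V. U = (\<lambda>(y, V). insert y V) u"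
      by (intro bexI[of _ "(y, U - {y})"]) simp_all
  qed
  from bij_betw_same_card[OF this] show ?thesis
    using assms finB by (simp add: card_cartesian_product n_subsets card_Diff_subset)
qed

text \<open>Disjoint pairs of a \<open>j\<close>-set and an \<open>s\<close>-set are counted in two
  ways. In the game, a random \<open>j\<close>-set avoids \<open>s\<close> occupied doors, and the
  factor of \<open>win_level\<close> for \<open>N - j\<close> untouched doors turns into the one for
  \<open>N\<close>.\<close>

lemma binomial_disjoint_ratio:
  assumes "j + s \<le> N"
  shows "real ((N - s) choose j) / (real (N choose j) * real ((N - j) choose s)) = 1 / real (N choose s)"
proof -
  have "(N choose (j + s)) * ((j + s) choose j) = (N choose j) * ((N - j) choose s)"
    using choose_mult[of j "j + s" N] assms by simp
  moreover have "(N choose (j + s)) * ((j + s) choose s) = (N choose s) * ((N - s) choose j)"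
    using choose_mult[of s "j + s" N] assms by simp
  moreover have "(j + s) choose s = (j + s) choose j"
    using binomial_symmetric[of s "j + s"] by simp
  ultimately have "(N choose j) * ((N - j) choose s) = (N choose s) * ((N - s) choose j)" by simp
  then have "real (N choose j) * real ((N - j) choose s) = real (N choose s) * real ((N - s) choose j)"
    by (metis of_nat_mult)
  moreover have "(N choose j) > 0" "(N choose s) > 0" "((N - j) choose s) > 0" "((N - s) choose j) > 0"
    using assms by auto
  ultimately show ?thesis by (simp add: field_simps)
qed

text \<open>Absorption reduces this to \<open>binomial_disjoint_ratio\<close> with
  \<open>N - 1\<close>. It serves the case that \<open>Suc j\<close> random doors hit exactly one of
  \<open>Suc s\<close> occupied doors.\<close>

lemma binomial_meeting_once_ratio:
  assumes "Suc j + s \<le> N"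
  shows "real (Suc s) * real ((N - Suc s) choose j) / (real (N choose Suc j) * real ((N - Suc j) choose s)) =
    real (Suc j) / real (N choose Suc s)"
proof -
  obtain N' where N: "N = Suc N'" using assms by (cases N) auto
  have 1: "real ((N' - s) choose j) / (real (N' choose j) * real ((N' - j) choose s)) = 1 / real (N' choose s)"
    by (rule binomial_disjoint_ratio) (use assms N in simp)
  have 2: "real (Suc j) * real (N choose Suc j) = real N * real (N' choose j)"
    "real (Suc s) * real (N choose Suc s) = real N * real (N' choose s)"
    using Suc_times_binomial_eq[of N' j] Suc_times_binomial_eq[of N' s]
    by (metis N mult.commute of_nat_mult)+
  have pos: "real (N choose Suc j) > 0" "real (N choose Suc s) > 0" "real (N' choose j) > 0"
    "real (N' choose s) > 0" "real ((N' - j) choose s) > 0" "real N > 0"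
    using assms N by (auto simp del: binomial_Suc_Suc)
  have 3: "real (N choose Suc j) = real N * real (N' choose j) / real (Suc j)"
    "real (N choose Suc s) = real N * real (N' choose s) / real (Suc s)"
    using 2 by (simp_all add: field_simps del: of_nat_Suc)
  have 4: "real ((N' - s) choose j) = real (N' choose j) * real ((N' - j) choose s) / real (N' choose s)"
    using 1 pos by (simp add: field_simps)
  have 5: "v * (a * b / c) / (M * a / u * b) = u / (M * c / v)" if "a > 0" "b > 0" "c > 0" "u > 0" "v > 0" "M > 0"
    for a b c u v M :: real
    using that by (simp add: field_simps)
  have "N - Suc s = N' - s" "N - Suc j = N' - j" using N by auto
  then show ?thesis unfolding 3 by (simp only: 4) (rule 5; use pos in simp)
qed

section \<open>The lower bound\<close>

text \<open>The searcher remembers the set \<open>T\<close> of doors guessed so far, the door \<open>x\<close> revealed last and the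
  number \<open>r\<close> of distinct doors revealed, while \<open>m\<close> treasures are still hidden. The next formula is the
  probability with which she finds remaining treasures that occupy, besides possibly \<open>x\<close>, exactly
  \<open>s\<close> doors, all of them outside \<open>T\<close>, where \<open>t = card T\<close>.\<close>

definition win_level :: "nat \<Rightarrow> nat \<Rightarrow> nat \<Rightarrow> nat \<Rightarrow> nat \<Rightarrow> nat \<Rightarrow> real" where
  "win_level n k m t r s =
     real k ^ m * real (n choose (r + s)) / (real ((n + m) choose (r + m)) * real ((n - t) choose s))"

text \<open>By the condition on \<open>M\<close>, no treasure remains behind a door guessed earlier
  other than \<open>x\<close>; plays that leave this situation are not counted towards the
  bound.\<close>

definition guarantees :: "nat \<Rightarrow> nat \<Rightarrow> nat \<Rightarrow> nat set \<Rightarrow> nat \<Rightarrow> nat \<Rightarrow> searcher pmf \<Rightarrow> bool" where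
  "guarantees n k m T x r p \<longleftrightarrow>
     (\<forall>\<rho> M. size M = m \<longrightarrow> set_mset M \<subseteq> insert x ({..<n} - T) \<longrightarrow>
        win_level n k m (card T) r (card (set_mset M - {x})) \<le>
          measure_pmf.prob p {\<sigma>. wins m \<sigma> \<rho> M []})"

text \<open>The bound on \<open>card T\<close> leaves enough new doors for \<open>m\<close> guesses,
  the one on \<open>r + m\<close> keeps the mixing probability at most 1. Validity is asked in every
  state so that gluing needs no side conditions.\<close>

definition guaranteeing :: "nat \<Rightarrow> nat \<Rightarrow> nat \<Rightarrow> (nat set \<Rightarrow> nat \<Rightarrow> nat \<Rightarrow> searcher pmf) \<Rightarrow> bool" where
  "guaranteeing n k m C \<longleftrightarrow>
     (\<forall>T x r. set_pmf (C T x r) \<subseteq> {\<sigma>. valid_searcher n k \<sigma>}) \<and>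
     (\<forall>T x r. T \<subseteq> {..<n} \<longrightarrow> x \<in> T \<longrightarrow> card T + k * m \<le> n \<longrightarrow> k * (r + m) \<le> n \<longrightarrow>
        guarantees n k m T x r (C T x r))"

lemma guaranteeingD:
  assumes "guaranteeing n k m C" "T \<subseteq> {..<n}" "x \<in> T" "card T + k * m \<le> n" "k * (r + m) \<le> n"
    and "size M = m" "set_mset M \<subseteq> insert x ({..<n} - T)"
  shows "win_level n k m (card T) r (card (set_mset M - {x})) \<le>
    measure_pmf.prob (C T x r) {\<sigma>. wins m \<sigma> \<rho> M []}"
  using assms unfolding guaranteeing_def guarantees_def by blast

section \<open>One round of the search\<close>

lemma set_mset_remove1_diff: "set_mset (M - {#y#}) - {y} = set_mset M - {y}"
proof (cases "y \<in># M")
  case True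
  then obtain M' where "M = add_mset y M'" by (metis insert_DiffM)
  then show ?thesis by auto
qed (simp add: diff_single_trivial)

text \<open>Comparing \<open>y\<close> with \<open>x\<close> alone keeps \<open>r\<close> correct,
  because no other guessed door is guessed again.\<close>

definition continuation ::
    "(nat set \<Rightarrow> nat \<Rightarrow> nat \<Rightarrow> searcher pmf) \<Rightarrow> nat set \<Rightarrow> nat \<Rightarrow> nat \<Rightarrow> nat set \<Rightarrow> nat \<Rightarrow> searcher pmf" where
  "continuation C T x r S y = C (T \<union> S) y (if y = x then r else Suc r)"

lemma card_untouched:
  fixes n :: nat
  assumes "T \<subseteq> {..<n}"
  shows "card ({..<n} - T) = n - card T"
  using assms by (simp add: card_Diff_subset finite_subset)

lemma card_touched:
  fixes n :: nat
  assumes "T \<subseteq> {..<n}" "E \<subseteq> T" "U \<subseteq> {..<n} - T"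
  shows "card (T \<union> (E \<union> U)) = card T + card U"
proof -
  have "T \<union> (E \<union> U) = T \<union> U" using assms by auto
  moreover have "finite T" using assms(1) by (rule finite_subset) simp
  moreover have "finite U" using assms(3) by (rule finite_subset) simp
  moreover have "T \<inter> U = {}" using assms by auto
  ultimately show ?thesis by (simp add: card_Un_disjoint)
qed

text \<open>A good draw hits exactly one occupied door. Then \<open>s\<close> falls and
  \<open>r\<close> rises by one, so \<open>n choose (r + s)\<close> is unchanged, and
  \<open>binomial_meeting_once_ratio\<close> supplies the factor \<open>j\<close>. The doors of
  \<open>E\<close> lie in \<open>T\<close> and hold nothing.\<close>

lemma prob_guess_new_door:
  assumes C: "guaranteeing n k m C"
    and T: "T \<subseteq> {..<n}" "E \<subseteq> T" and jk: "j \<le> k" and k: "k > 0"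
    and bounds: "card T + k * Suc m \<le> n" "k * (r + Suc m) \<le> n"
    and M: "size M = Suc m" "set_mset M \<subseteq> {..<n} - T" "x \<notin># M"
  defines "s \<equiv> card (set_mset M)"
  shows "real j * (real k ^ m * real (n choose (r + s)) /
      (real ((n + m) choose (r + Suc m)) * real ((n - card T) choose s)))
    \<le> measure_pmf.prob (random_guess n (continuation C T x r) E ({..<n} - T) j)
        {\<sigma>. wins (Suc m) \<sigma> \<rho> M []}"
proof (cases j)
  \<comment> \<open>This happens for \<open>k = 1\<close> when the last door is the whole
    guess.\<close>
  case 0
  then show ?thesis by simp
next
  case (Suc i)
  let ?A = "{..<n} - T" and ?B = "set_mset M"
  define X where "X = {U. U \<subseteq> ?A \<and> card U = j \<and> (\<exists>y. U \<inter> ?B = {y})}"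
  have "M \<noteq> {#}" using M by auto
  then have "s > 0" by (simp add: s_def card_gt_0_iff)
  then obtain s' where s': "s = Suc s'" by (cases s) auto
  have "s \<le> Suc m" using size_multiset_overloaded_eq[of M] M(1) sum_mono[of ?B "\<lambda>_. 1" "count M"]
    by (simp add: s_def Suc_le_eq)
  have mk: "m \<le> k * m" using k by simp
  \<comment> \<open>\<open>Suc i\<close> is at most \<open>k\<close> and \<open>s'\<close> at most
    \<open>m \<le> k * m\<close>, while at least \<open>k + k * m\<close> doors are
    untouched.\<close>
  have N: "Suc i + s' \<le> n - card T"
    using \<open>s \<le> Suc m\<close> s' bounds jk Suc mk unfolding mult_Suc_right by linarith
  have cardA: "card ?A = n - card T" by (rule card_untouched) (rule T)
  have cardX: "real (card X) = real s * real ((n - card T - s) choose i)"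
    using card_subsets_meeting_once[of ?A ?B i] M cardA by (simp add: X_def Suc s_def)
  have "real (card X) / real (card ?A choose j) * win_level n k m (card T + j) (Suc r) s'
    \<le> measure_pmf.prob (random_guess n (continuation C T x r) E ?A j) {\<sigma>. wins (Suc m) \<sigma> \<rho> M []}"
  proof (rule prob_random_guess_ge)
    fix U assume "U \<in> X"
    then obtain y where U: "U \<subseteq> ?A" "card U = j" "U \<inter> ?B = {y}" by (auto simp: X_def)
    then have y: "y < n" "y \<in># M" "y \<in> U" "y \<noteq> x" using M(3) by auto
    have T': "card (T \<union> (E \<union> U)) = card T + j"
      using card_touched[OF T U(1)] U(2) by simp
    have "card (set_mset (M - {#y#}) - {y}) = s'"
      using y s' by (simp add: set_mset_remove1_diff s_def)
    moreover have "size (M - {#y#}) = m" using M y by (simp add: size_Diff_singleton)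
    moreover have "set_mset (M - {#y#}) \<subseteq> insert y ({..<n} - (T \<union> (E \<union> U)))"
      using M(2) U T set_mset_remove1_diff[of M y] by blast
    moreover have "T \<union> (E \<union> U) \<subseteq> {..<n}" "y \<in> T \<union> (E \<union> U)" using T U y by auto
    moreover have "card (T \<union> (E \<union> U)) + k * m \<le> n" "k * (Suc r + m) \<le> n"
      using T' bounds jk by auto
    ultimately have "win_level n k m (card T + j) (Suc r) s' \<le>
      measure_pmf.prob (C (T \<union> (E \<union> U)) y (Suc r))
        {\<sigma>. wins m \<sigma> (\<lambda>h. \<rho> ((E \<union> U, y) # h)) (M - {#y#}) []}"
      using guaranteeingD[OF C] T' by metis
    moreover have "(E \<union> U) \<inter> ?B = {y}" using U T M(2) by auto
    ultimately show "\<exists>y<n. (E \<union> U) \<inter> ?B = {y} \<and> win_level n k m (card T + j) (Suc r) s' \<le>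
        measure_pmf.prob (continuation C T x r (E \<union> U) y)
          {\<sigma>. wins m \<sigma> (\<lambda>h. \<rho> ((E \<union> U, y) # h)) (M - {#y#}) []}"
      using y by (auto simp: continuation_def)
  qed (use N Suc cardA in \<open>auto simp: X_def\<close>)
  also have "real (card X) / real (card ?A choose j) * win_level n k m (card T + j) (Suc r) s' =
      real (Suc s') * real ((n - card T - Suc s') choose i) /
        (real ((n - card T) choose Suc i) * real ((n - card T - Suc i) choose s')) *
      (real k ^ m * real (n choose (r + s)) / real ((n + m) choose (r + Suc m)))"
    using Suc cardX cardA s' by (simp add: win_level_def field_simps)
  also have "\<dots> = real j * (real k ^ m * real (n choose (r + s)) /
      (real ((n + m) choose (r + Suc m)) * real ((n - card T) choose s)))"
    unfolding binomial_meeting_once_ratio[OF N] Suc s' by (simp add: mult_ac del: of_nat_Suc)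
  finally show ?thesis .
qed

text \<open>The answer is forced to be \<open>x\<close> when the new doors avoid all other occupied
  doors. Then \<open>r\<close> and \<open>s\<close> stay the same and only \<open>T\<close> grows,
  which \<open>binomial_disjoint_ratio\<close> compensates.\<close>

lemma prob_guess_last_door:
  assumes C: "guaranteeing n k m C"
    and T: "T \<subseteq> {..<n}" "x \<in> T" and k: "k > 0"
    and bounds: "card T + k * Suc m \<le> n" "k * (r + Suc m) \<le> n"
    and M: "size M = Suc m" "set_mset M \<subseteq> insert x ({..<n} - T)" "x \<in># M"
  defines "s \<equiv> card (set_mset M - {x})"
  shows "real k ^ m * real (n choose (r + s)) /
      (real ((n + m) choose (r + m)) * real ((n - card T) choose s))
    \<le> measure_pmf.prob (random_guess n (continuation C T x r) {x} ({..<n} - T) (k - 1))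
        {\<sigma>. wins (Suc m) \<sigma> \<rho> M []}"
proof -
  let ?A = "{..<n} - T" and ?B = "set_mset M - {x}"
  define j where "j = k - 1"
  define X where "X = {U. U \<subseteq> ?A \<and> card U = j \<and> U \<inter> ?B = {}}"
  have "card (set_mset M) \<le> Suc m"
    using size_multiset_overloaded_eq[of M] M(1) sum_mono[of "set_mset M" "\<lambda>_. 1" "count M"]
    by (simp add: Suc_le_eq)
  then have "s \<le> m" using M(3) by (simp add: s_def)
  have mk: "m \<le> k * m" using k by simp
  have N: "j + s \<le> n - card T"
    using \<open>s \<le> m\<close> bounds mk unfolding j_def mult_Suc_right by linarith
  have cardA: "card ?A = n - card T" by (rule card_untouched) (rule T)
  have BA: "?B \<subseteq> ?A" using M by auto
  have cardX: "card X = (n - card T - s) choose j"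
    using card_subsets_disjoint[OF _ BA, of j] cardA by (simp add: X_def s_def)
  have "real (card X) / real (card ?A choose j) * win_level n k m (card T + j) r s
    \<le> measure_pmf.prob (random_guess n (continuation C T x r) {x} ?A j) {\<sigma>. wins (Suc m) \<sigma> \<rho> M []}"
  proof (rule prob_random_guess_ge)
    fix U assume "U \<in> X"
    then have U: "U \<subseteq> ?A" "card U = j" "U \<inter> ?B = {}" by (auto simp: X_def)
    have T': "card (T \<union> ({x} \<union> U)) = card T + j"
      using card_touched[of T n "{x}", OF T(1) _ U(1)] T(2) U(2) by simp
    have "card (set_mset (M - {#x#}) - {x}) = s"
      by (simp add: set_mset_remove1_diff s_def)
    moreover have "size (M - {#x#}) = m" using M by (simp add: size_Diff_singleton)
    moreover have "set_mset (M - {#x#}) \<subseteq> insert x ({..<n} - (T \<union> ({x} \<union> U)))"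
      using M(2) U set_mset_remove1_diff[of M x] by blast
    moreover have "T \<union> ({x} \<union> U) \<subseteq> {..<n}" "x \<in> T \<union> ({x} \<union> U)" using T U by auto
    moreover have "card (T \<union> ({x} \<union> U)) + k * m \<le> n" "k * (r + m) \<le> n"
      using T' bounds unfolding j_def by auto
    ultimately have "win_level n k m (card T + j) r s \<le>
      measure_pmf.prob (C (T \<union> ({x} \<union> U)) x r)
        {\<sigma>. wins m \<sigma> (\<lambda>h. \<rho> (({x} \<union> U, x) # h)) (M - {#x#}) []}"
      using guaranteeingD[OF C] T' by metis
    moreover have "({x} \<union> U) \<inter> set_mset M = {x}" "x < n" using U T M by auto
    ultimately show "\<exists>y<n. ({x} \<union> U) \<inter> set_mset M = {y} \<and> win_level n k m (card T + j) r s \<le>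
        measure_pmf.prob (continuation C T x r ({x} \<union> U) y)
          {\<sigma>. wins m \<sigma> (\<lambda>h. \<rho> (({x} \<union> U, y) # h)) (M - {#y#}) []}"
      by (auto simp: continuation_def)
  qed (use N cardA in \<open>auto simp: X_def\<close>)
  also have "real (card X) / real (card ?A choose j) * win_level n k m (card T + j) r s =
      real ((n - card T - s) choose j) / (real ((n - card T) choose j) * real ((n - card T - j) choose s)) *
      (real k ^ m * real (n choose (r + s)) / real ((n + m) choose (r + m)))"
    using cardX cardA by (simp add: win_level_def field_simps)
  also have "\<dots> = real k ^ m * real (n choose (r + s)) /
      (real ((n + m) choose (r + m)) * real ((n - card T) choose s))"
    unfolding binomial_disjoint_ratio[OF N] by (simp add: mult_ac)
  finally show ?thesis unfolding j_def .
qed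

section \<open>Mixing the two kinds of guess\<close>

lemma prob_mix:
  assumes "0 \<le> q" "q \<le> 1"
  shows "measure_pmf.prob (bind_pmf (bernoulli_pmf q) (\<lambda>b. if b then p1 else p0)) X =
    q * measure_pmf.prob p1 X + (1 - q) * measure_pmf.prob p0 X"
  using assms by (simp add: prob_bind_pmf)

text \<open>The cases \<open>x \<in># M\<close> and \<open>x \<notin># M\<close> ask that
  \<open>q / k\<close> and \<open>1 - q / k\<close> be the ratios of
  \<open>(n + m) choose (r + m)\<close> and \<open>(n + m) choose (r + Suc m)\<close> to
  \<open>(n + Suc m) choose (r + Suc m)\<close>. By Pascal's rule these add up to 1, so one
  \<open>q\<close> serves both.\<close>

lemma ex_guarantees_Suc:
  assumes C: "guaranteeing n k m C" and k: "k > 0"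
    and T: "T \<subseteq> {..<n}" "x \<in> T"
    and bounds: "card T + k * Suc m \<le> n" "k * (r + Suc m) \<le> n"
  shows "\<exists>p. set_pmf p \<subseteq> {\<sigma>. valid_searcher n k \<sigma>} \<and> guarantees n k (Suc m) T x r p"
proof -
  let ?A = "{..<n} - T"
  define q where "q = real k * real (r + Suc m) / real (n + Suc m)"
  have "real (k * (r + Suc m)) \<le> real n" using bounds(2) by (rule of_nat_mono)
  then have q: "0 \<le> q" "q \<le> 1" by (auto simp: q_def field_simps)
  define p1 where "p1 = random_guess n (continuation C T x r) {x} ?A (k - 1)"
  define p0 where "p0 = random_guess n (continuation C T x r) {} ?A k"
  define p where "p = bind_pmf (bernoulli_pmf q) (\<lambda>b. if b then p1 else p0)"
  have cardA: "card ?A = n - card T" by (rule card_untouched) (rule T)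
  have C': "set_pmf (continuation C T x r S y) \<subseteq> {\<sigma>. valid_searcher n k \<sigma>}" for S y
    using C by (auto simp: guaranteeing_def continuation_def)
  have "set_pmf p1 \<subseteq> {\<sigma>. valid_searcher n k \<sigma>}" unfolding p1_def
    by (rule set_pmf_random_guess) (use T k bounds cardA C' in auto)
  moreover have "set_pmf p0 \<subseteq> {\<sigma>. valid_searcher n k \<sigma>}" unfolding p0_def
    by (rule set_pmf_random_guess) (use T k bounds cardA C' in auto)
  ultimately have valid: "set_pmf p \<subseteq> {\<sigma>. valid_searcher n k \<sigma>}"
    by (auto simp: p_def split: if_splits)
  have "r + Suc m \<le> k * (r + Suc m)" using k by (cases k) auto
  then have rn: "r < n" using bounds(2) by linarith
  have "guarantees n k (Suc m) T x r p"
    unfolding guarantees_def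
  proof (intro allI impI)
    fix \<rho> M
    assume M: "size M = Suc m" "set_mset M \<subseteq> insert x ({..<n} - T)"
    define s where "s = card (set_mset M - {x})"
    let ?W = "{\<sigma>. wins (Suc m) \<sigma> \<rho> M []}"
    have pr: "measure_pmf.prob p ?W = q * measure_pmf.prob p1 ?W + (1 - q) * measure_pmf.prob p0 ?W"
      unfolding p_def by (rule prob_mix) (rule q)+
    have pos: "real ((n + m) choose (r + m)) > 0" "real ((n + Suc m) choose (r + Suc m)) > 0"
      using rn by (auto simp del: binomial_Suc_Suc)
    show "win_level n k (Suc m) (card T) r (card (set_mset M - {x})) \<le> measure_pmf.prob p ?W"
    proof (cases "x \<in># M")
      case True
      let ?v = "real k ^ m * real (n choose (r + s)) /
        (real ((n + m) choose (r + m)) * real ((n - card T) choose s))"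
      have "?v \<le> measure_pmf.prob p1 ?W"
        unfolding p1_def s_def by (rule prob_guess_last_door[OF C T k bounds M True])
      then have "q * ?v \<le> q * measure_pmf.prob p1 ?W"
        using q by (intro mult_left_mono)
      \<comment> \<open>\<open>p0\<close> leaves out \<open>x\<close>, and its contribution is
        estimated by 0.\<close>
      also have "\<dots> \<le> measure_pmf.prob p ?W" using pr q by simp
      finally have bound: "q * ?v \<le> measure_pmf.prob p ?W" .
      have "real (r + Suc m) * real ((n + Suc m) choose (r + Suc m)) =
          real (n + Suc m) * real ((n + m) choose (r + m))"
        using Suc_times_binomial_eq[of "n + m" "r + m"] by (metis add_Suc_right mult.commute of_nat_mult)
      then have "real (r + Suc m) / real (n + Suc m) / real ((n + m) choose (r + m)) =
          1 / real ((n + Suc m) choose (r + Suc m))"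
        using pos by (simp add: frac_eq_eq mult.commute del: of_nat_Suc of_nat_add binomial_Suc_Suc)
      moreover have "q * ?v = real k ^ Suc m * real (n choose (r + s)) *
          (real (r + Suc m) / real (n + Suc m) / real ((n + m) choose (r + m))) / real ((n - card T) choose s)"
        by (simp add: q_def mult_ac del: of_nat_Suc of_nat_add)
      ultimately have "q * ?v = win_level n k (Suc m) (card T) r s"
        by (simp add: win_level_def del: binomial_Suc_Suc)
      with bound show ?thesis by (simp add: s_def)
    next
      case False
      then have M': "set_mset M \<subseteq> {..<n} - T" and s: "s = card (set_mset M)" using M by (auto simp: s_def)
      let ?v = "real k ^ m * real (n choose (r + s)) /
        (real ((n + m) choose (r + Suc m)) * real ((n - card T) choose s))"
      have "real (k - 1) * ?v \<le> measure_pmf.prob p1 ?W"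
        unfolding p1_def s
        by (rule prob_guess_new_door[OF C T(1) _ _ k bounds M(1) M' False]) (use T in auto)
      then have p1_ge: "q * (real (k - 1) * ?v) \<le> q * measure_pmf.prob p1 ?W"
        using q by (intro mult_left_mono)
      have "real k * ?v \<le> measure_pmf.prob p0 ?W"
        unfolding p0_def s
        by (rule prob_guess_new_door[OF C T(1) _ _ k bounds M(1) M' False]) auto
      then have p0_ge: "(1 - q) * (real k * ?v) \<le> (1 - q) * measure_pmf.prob p0 ?W"
        using q by (intro mult_left_mono) auto
      \<comment> \<open>The expected number of new doors is \<open>k - q\<close>, as
        \<open>x\<close> takes one place with probability \<open>q\<close>.\<close>
      have mix: "q * (real (k - 1) * v) + (1 - q) * (real k * v) = (real k - q) * v" for v
        using k by (simp add: of_nat_diff algebra_simps)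
      from p1_ge p0_ge have bound: "(real k - q) * ?v \<le> measure_pmf.prob p ?W"
        using pr mix[of ?v] by linarith
      \<comment> \<open>\<open>z\<close> is \<open>1 - q / k\<close>.\<close>
      define z where "z = 1 - real (r + Suc m) / real (n + Suc m)"
      have z: "z = real (n - r) / real (n + Suc m)"
        using rn by (simp add: z_def field_simps of_nat_diff)
      have absorb: "real (n - r) * real ((n + Suc m) choose (r + Suc m)) =
          real (n + Suc m) * real ((n + m) choose (r + Suc m))"
        using arg_cong[OF binomial_absorb_comp[of "n + Suc m" "r + Suc m"], of real]
        by (simp del: of_nat_Suc of_nat_add binomial_Suc_Suc of_nat_diff mult_Suc)
      have "real ((n + m) choose (r + Suc m)) > 0" using rn by simp
      then have "z / real ((n + m) choose (r + Suc m)) = 1 / real ((n + Suc m) choose (r + Suc m))"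
        unfolding z using absorb pos
        by (simp add: frac_eq_eq mult.commute del: of_nat_Suc of_nat_add binomial_Suc_Suc of_nat_diff)
      moreover have "real k - q = real k * z"
        by (simp add: q_def z_def right_diff_distrib del: of_nat_Suc of_nat_add)
      then have "(real k - q) * ?v = real k ^ Suc m * real (n choose (r + s)) *
          (z / real ((n + m) choose (r + Suc m))) / real ((n - card T) choose s)"
        by simp
      ultimately have "(real k - q) * ?v = win_level n k (Suc m) (card T) r s"
        by (simp add: win_level_def del: binomial_Suc_Suc)
      with bound show ?thesis by (simp add: s_def)
    qed
  qed
  with valid show ?thesis by blast
qed

text \<open>Induction with a choice of one strategy per state. For \<open>m = 0\<close> any valid
  strategy serves: the game is already won and \<open>win_level\<close> is at most 1.\<close>

lemma ex_guaranteeing: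
  assumes k: "k > 0"
  shows "\<exists>C. guaranteeing n k m C"
proof (induction m)
  case 0
  have "guaranteeing n k 0 (\<lambda>_ _ _. return_pmf (\<lambda>_. {}))"
    by (auto simp: guaranteeing_def guarantees_def win_level_def valid_searcher_def)
  then show ?case by blast
next
  case (Suc m)
  then obtain C where C: "guaranteeing n k m C" by blast
  let ?ok = "\<lambda>T x r. T \<subseteq> {..<n} \<and> x \<in> T \<and> card T + k * Suc m \<le> n \<and> k * (r + Suc m) \<le> n"
  \<comment> \<open>States outside the bounds receive the strategy that guesses nothing, so that the
    choice function is valid everywhere.\<close>
  have "\<exists>p. set_pmf p \<subseteq> {\<sigma>. valid_searcher n k \<sigma>} \<and> (?ok T x r \<longrightarrow> guarantees n k (Suc m) T x r p)"
    for T x r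
  proof (cases "?ok T x r")
    case True
    then show ?thesis using ex_guarantees_Suc[OF C k, of T x r] by auto
  next
    case False
    then show ?thesis by (intro exI[of _ "return_pmf (\<lambda>_. {})"]) (auto simp: valid_searcher_def)
  qed
  then obtain C' where "\<And>T x r. set_pmf (C' T x r) \<subseteq> {\<sigma>. valid_searcher n k \<sigma>} \<and>
      (?ok T x r \<longrightarrow> guarantees n k (Suc m) T x r (C' T x r))"
    by metis
  then have "guaranteeing n k (Suc m) C'" unfolding guaranteeing_def by blast
  then show ?case by blast
qed

text \<open>The first round has only new doors and needs no mixing. With \<open>r = 0\<close> and
  \<open>T\<close> empty the binomials in the number \<open>s\<close> of occupied doors cancel, so
  every placement gets the same bound.\<close>

lemma ex_optimal_search:
  assumes d: "d > 0" and k: "k > 0" and n: "k * d \<le> n"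
  shows "\<exists>p. set_pmf p \<subseteq> {\<sigma>. valid_searcher n k \<sigma>} \<and>
    (\<forall>c\<in>placements n d. \<forall>\<rho>. real k ^ d / real ((n + d - 1) choose d) \<le> win_prob d p c \<rho>)"
proof -
  obtain m where m: "d = Suc m" using d by (cases d) auto
  obtain C where C: "guaranteeing n k m C" using ex_guaranteeing[OF k] by blast
  \<comment> \<open>There is no last revealed door yet; \<open>n\<close>, which is not a door, takes its place.\<close>
  define p where "p = random_guess n (continuation C {} n 0) {} {..<n} k"
  have "k \<le> n" using n d by (metis One_nat_def Suc_leI le_trans mult_le_mono2 nat_mult_1_right)
  then have "set_pmf p \<subseteq> {\<sigma>. valid_searcher n k \<sigma>}"
    unfolding p_def using C
    by (intro set_pmf_random_guess) (auto simp: guaranteeing_def continuation_def)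
  moreover have "real k ^ d / real ((n + d - 1) choose d) \<le> win_prob d p c \<rho>"
    if c: "c \<in> placements n d" for c \<rho>
  proof -
    define s where "s = card (set_mset c)"
    have c': "size c = Suc m" "set_mset c \<subseteq> {..<n}" using c m by (auto simp: placements_def)
    have "s \<le> n" using card_mono[OF _ c'(2)] by (simp add: s_def)
    have "real k * (real k ^ m * real (n choose (0 + s)) /
        (real ((n + m) choose (0 + Suc m)) * real ((n - card ({} :: nat set)) choose s)))
      \<le> measure_pmf.prob (random_guess n (continuation C {} n 0) {} ({..<n} - {}) k)
          {\<sigma>. wins (Suc m) \<sigma> \<rho> c []}"
      unfolding s_def by (rule prob_guess_new_door[OF C]) (use c' n k m in auto)
    then have "real k * (real k ^ m * real (n choose s) /
        (real ((n + m) choose Suc m) * real (n choose s))) \<le> win_prob d p c \<rho>"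
      by (simp add: win_prob_def p_def m del: wins.simps)
    then show ?thesis using \<open>s \<le> n\<close> m by simp
  qed
  ultimately show ?thesis by blast
qed

section \<open>The value of the game\<close>

theorem theorem2:
  fixes d k :: nat
  assumes "d > 0" and "k > 0"
  shows "\<exists>N::nat. \<forall>n\<ge>N. vM n d k = real k ^ d / real ((n + d - 1) choose d)"
proof (intro exI[of _ "k * d"] allI impI)
  \<comment> \<open>\<open>k * d\<close> doors suffice for \<open>d\<close> guesses of new doors and
    for mixing probabilities at most 1, as \<open>r + m\<close> never exceeds
    \<open>d\<close>.\<close>
  fix n assume n: "k * d \<le> n"
  let ?V = "real k ^ d / real ((n + d - 1) choose d)"
  let ?Q = "{p. set_pmf p \<subseteq> {\<sigma>. valid_searcher n k \<sigma>}}"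
  let ?I = "\<lambda>p. INF hc \<in> placements n d \<times> (UNIV :: hrule set). win_prob d p (fst hc) (snd hc)"
  have "n > 0" using n assms by (metis gr0I mult_is_0 not_gr0 le_zero_eq)
  have card: "card (placements n d) = (n + d - 1) choose d"
    by (simp add: placements_eq card_multisets_of_size)
  have pos: "card (placements n d) > 0" using \<open>n > 0\<close> card by simp
  then have ne: "placements n d \<noteq> {}" by auto
  have bdd: "bdd_below ((\<lambda>hc. win_prob d p (fst hc) (snd hc)) ` (placements n d \<times> UNIV))" for p
    by (rule bdd_belowI[of _ 0]) (auto simp: win_prob_def)
  have upper: "?I p \<le> ?V" if p: "p \<in> ?Q" for p
  proof -
    \<comment> \<open>Any one rule serves: the infimum is at most the average over the placements
      against it.\<close>
    fix \<rho> :: hrule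
    have "real (card (placements n d)) * ?I p = (\<Sum>c\<in>placements n d. ?I p)" by simp
    also have "\<dots> \<le> (\<Sum>c\<in>placements n d. win_prob d p c \<rho>)"
    proof (rule sum_mono)
      fix c assume "c \<in> placements n d"
      then show "?I p \<le> win_prob d p c \<rho>" using cINF_lower[OF bdd, of "(c, \<rho>)"] by simp
    qed
    also have "\<dots> \<le> real k ^ d" using p by (intro sum_win_prob_le) auto
    finally show ?thesis using pos card by (simp add: field_simps)
  qed
  obtain p where p: "p \<in> ?Q" "\<And>c \<rho>. c \<in> placements n d \<Longrightarrow> ?V \<le> win_prob d p c \<rho>"
    using ex_optimal_search[OF assms n] by auto
  have "?V \<le> ?I p"
    using ne p(2) by (intro cINF_greatest) auto
  also have "\<dots> \<le> vM n d k"
    unfolding vM_def using upper p(1) by (intro cSUP_upper bdd_aboveI[of _ ?V]) auto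
  finally have "?V \<le> vM n d k" .
  moreover have "vM n d k \<le> ?V"
    unfolding vM_def using p(1) upper by (intro cSUP_least) auto
  ultimately show "vM n d k = ?V" by simp
qed

end
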